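(* Let $\Delta$ be a flag $3$-dimensional Eulerian complex on $n$ vertices. Then $f_1(\Delta)\leq f_1(J_2(n))=\lfloor n^2/4\rfloor+n$.
   Context: A simplicial complex is flag if every minimal non-face has exactly two elements. For a face $\sigma$, $\mathrm{lk}_\Delta\sigma=\{\tau-\sigma:\sigma\subseteq\tau\in\Delta\}$. The reduced Euler characteristic is $\chi(\Gamma)=\sum_i(-1)^i\beta_i(\Gamma;\mathbf{k})$ (reduced Betti numbers over a field $\mathbf{k}$). A complex $\Delta$ is Eulerian if it is pure and $\chi(\mathrm{lk}_\Delta\sigma)=(-1)^{\dim\mathrm{lk}_\Delta\sigma}$ for every face $\sigma$, including $\sigma=\emptyset$. $f_1$ is the number of edges. $J_2(n)$ is the join of two cycles with $\lfloor n/2\rfloor$ and $\lceil n/2\rceil$ vertices. *)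

theory Defs
  imports Complex_Main "HOL-Library.Function_Algebras"
begin

definition simplicial_complex :: "'a set set \<Rightarrow> bool" where
  "simplicial_complex K \<longleftrightarrow>
     finite K \<and> {} \<in> K \<and> (\<forall>\<sigma>\<in>K. finite \<sigma>) \<and> (\<forall>\<sigma>\<in>K. \<forall>\<tau>. \<tau> \<subseteq> \<sigma> \<longrightarrow> \<tau> \<in> K)"

definition vertices :: "'a set set \<Rightarrow> 'a set" where
  "vertices K = \<Union>K"

definition face_dim :: "'a set \<Rightarrow> int" where
  "face_dim \<sigma> = int (card \<sigma>) - 1"

definition complex_dim :: "'a set set \<Rightarrow> int" where
  "complex_dim K = Max (face_dim ` K)"

definition face_number :: "int \<Rightarrow> 'a set set \<Rightarrow> nat" where
  "face_number i K = card {\<sigma>\<in>K. face_dim \<sigma> = i}"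

definition facet :: "'a set set \<Rightarrow> 'a set \<Rightarrow> bool" where
  "facet K \<sigma> \<longleftrightarrow> \<sigma> \<in> K \<and> (\<forall>\<tau>\<in>K. \<sigma> \<subseteq> \<tau> \<longrightarrow> \<tau> = \<sigma>)"

definition pure :: "'a set set \<Rightarrow> bool" where
  "pure K \<longleftrightarrow> (\<forall>\<sigma> \<tau>. facet K \<sigma> \<longrightarrow> facet K \<tau> \<longrightarrow> face_dim \<sigma> = face_dim \<tau>)"

definition link :: "'a set set \<Rightarrow> 'a set \<Rightarrow> 'a set set" where
  "link K \<sigma> = {\<tau> - \<sigma> |\<tau>. \<sigma> \<subseteq> \<tau> \<and> \<tau> \<in> K}"

definition minimal_nonface :: "'a set set \<Rightarrow> 'a set \<Rightarrow> bool" where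
  "minimal_nonface K \<sigma> \<longleftrightarrow> \<sigma> \<subseteq> vertices K \<and> \<sigma> \<notin> K \<and> (\<forall>\<tau>. \<tau> \<subset> \<sigma> \<longrightarrow> \<tau> \<in> K)"

definition flag :: "'a set set \<Rightarrow> bool" where
  "flag K \<longleftrightarrow> (\<forall>\<sigma>. minimal_nonface K \<sigma> \<longrightarrow> card \<sigma> = 2)"

text \<open>
  Reduced simplicial homology over a field. A chain is a coefficient function on faces. Faces
  are oriented by an arbitrary numbering of the vertices, on which the Betti numbers do not
  depend. The empty face spans the chains of degree \<open>-1\<close>, so the boundary map in degree 0 is
  the augmentation.
\<close>

definition vertex_numbering :: "'a set set \<Rightarrow> 'a \<Rightarrow> nat" where
  "vertex_numbering K = (SOME f. inj_on f (vertices K))"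

definition chain_scale :: "'k::field \<Rightarrow> ('a set \<Rightarrow> 'k) \<Rightarrow> 'a set \<Rightarrow> 'k" where
  "chain_scale a c = (\<lambda>\<sigma>. a * c \<sigma>)"

interpretation chains: vector_space chain_scale
  by unfold_locales (auto simp: chain_scale_def fun_eq_iff algebra_simps)

definition chain_group :: "'a set set \<Rightarrow> int \<Rightarrow> ('a set \<Rightarrow> 'k::field) set" where
  "chain_group K i = {c. \<forall>\<sigma>. c \<sigma> \<noteq> 0 \<longrightarrow> \<sigma> \<in> K \<and> face_dim \<sigma> = i}"

text \<open>
  The number of vertices of \<open>\<tau>\<close> preceding \<open>v\<close> is the position of \<open>v\<close> in the ordered face
  \<open>insert v \<tau>\<close>, so this is the usual alternating sum, read off coefficientwise.
\<close>

definition incidence_sign :: "'a set set \<Rightarrow> 'a \<Rightarrow> 'a set \<Rightarrow> 'k::field" where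
  "incidence_sign K v \<tau> =
     (- 1) ^ card {u\<in>\<tau>. vertex_numbering K u < vertex_numbering K v}"

definition boundary_map :: "'a set set \<Rightarrow> ('a set \<Rightarrow> 'k::field) \<Rightarrow> 'a set \<Rightarrow> 'k" where
  "boundary_map K c =
     (\<lambda>\<tau>. \<Sum>v\<in>vertices K - \<tau>. incidence_sign K v \<tau> * c (insert v \<tau>))"

definition cycle_group :: "'a set set \<Rightarrow> int \<Rightarrow> ('a set \<Rightarrow> 'k::field) set" where
  "cycle_group K i = {c \<in> chain_group K i. boundary_map K c = 0}"

definition boundary_group :: "'a set set \<Rightarrow> int \<Rightarrow> ('a set \<Rightarrow> 'k::field) set" where
  "boundary_group K i = boundary_map K ` chain_group K (i + 1)"

text \<open>
  The dimension of the quotient of the cycles by the boundaries; see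
  \<open>boundary_group_subset\<close> below.
\<close>

definition reduced_betti :: "'k::field itself \<Rightarrow> 'a set set \<Rightarrow> int \<Rightarrow> int" where
  "reduced_betti _ K i =
     int (chains.dim (cycle_group K i :: ('a set \<Rightarrow> 'k) set))
     - int (chains.dim (boundary_group K i :: ('a set \<Rightarrow> 'k) set))"

definition parity_sign :: "int \<Rightarrow> int" where
  "parity_sign i = (if even i then 1 else - 1)"

definition reduced_euler_char :: "'k::field itself \<Rightarrow> 'a set set \<Rightarrow> int" where
  "reduced_euler_char F K = (\<Sum>i = -1..complex_dim K. parity_sign i * reduced_betti F K i)"

definition eulerian :: "'k::field itself \<Rightarrow> 'a set set \<Rightarrow> bool" where
  "eulerian F K \<longleftrightarrow>
     pure K \<and>
     (\<forall>\<sigma>\<in>K. reduced_euler_char F (link K \<sigma>) = parity_sign (complex_dim (link K \<sigma>)))"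

text \<open>The cycle with vertices \<open>0, \<dots>, m - 1\<close>; meaningful for \<open>m \<ge> 3\<close>.\<close>

definition cycle_complex :: "nat \<Rightarrow> nat set set" where
  "cycle_complex m = {{}} \<union> {{i} |i. i < m} \<union> {{i, (i + 1) mod m} |i. i < m}"

text \<open>The disjoint sum of types makes the two vertex sets disjoint.\<close>

definition complex_join :: "'a set set \<Rightarrow> 'b set set \<Rightarrow> ('a + 'b) set set" where
  "complex_join K L = {\<sigma> <+> \<tau> |\<sigma> \<tau>. \<sigma> \<in> K \<and> \<tau> \<in> L}"

definition J2 :: "nat \<Rightarrow> (nat + nat) set set" where
  "J2 n = complex_join (cycle_complex (n div 2)) (cycle_complex ((n + 1) div 2))"

lemma finite_vertices: "simplicial_complex K \<Longrightarrow> finite (vertices K)"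
  by (auto simp: simplicial_complex_def vertices_def)

lemma inj_on_vertex_numbering:
  fixes K :: "'a set set"
  assumes "simplicial_complex K"
  shows "inj_on (vertex_numbering K) (vertices K)"
proof -
  have "\<exists>f :: 'a \<Rightarrow> nat. inj_on f (vertices K)"
    using finite_imp_inj_to_nat_seg[OF finite_vertices[OF assms]] by blast
  then show ?thesis unfolding vertex_numbering_def by (rule someI_ex)
qed

lemma incidence_sign_insert:
  assumes "finite \<tau>" "w \<notin> \<tau>"
  shows "incidence_sign K v (insert w \<tau>) =
    (if vertex_numbering K w < vertex_numbering K v then - incidence_sign K v \<tau>
     else incidence_sign K v \<tau> :: 'k::field)"
proof (cases "vertex_numbering K w < vertex_numbering K v")
  case True
  then have "{u\<in>insert w \<tau>. vertex_numbering K u < vertex_numbering K v} =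
    insert w {u\<in>\<tau>. vertex_numbering K u < vertex_numbering K v}" by auto
  then show ?thesis using True assms by (simp add: incidence_sign_def)
next
  case False
  then have "{u\<in>insert w \<tau>. vertex_numbering K u < vertex_numbering K v} =
    {u\<in>\<tau>. vertex_numbering K u < vertex_numbering K v}" by auto
  then show ?thesis using False by (simp add: incidence_sign_def)
qed

lemma boundary_boundary:
  fixes c :: "'a set \<Rightarrow> 'k::field"
  assumes K: "simplicial_complex K" and c: "c \<in> chain_group K i"
  shows "boundary_map K (boundary_map K c) = 0"
proof
  fix \<tau>
  let ?V = "vertices K" and ?p = "vertex_numbering K"
  define h :: "'a \<times> 'a \<Rightarrow> 'k" where
    "h = (\<lambda>(v, w). incidence_sign K v \<tau> * incidence_sign K w (insert v \<tau>)
            * c (insert w (insert v \<tau>)))"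
  define P where "P = (SIGMA v:?V - \<tau>. ?V - insert v \<tau>)"
  have finV: "finite ?V" by (rule finite_vertices[OF K])
  have finP: "finite P" using finV by (simp add: P_def)
  have "boundary_map K (boundary_map K c) \<tau> = sum h P"
    unfolding boundary_map_def P_def h_def using finV
    by (simp add: sum.Sigma[symmetric] sum_distrib_left mult.assoc)
  also have "\<dots> = 0"
  proof (cases "finite \<tau>")
    case False
    have "c (insert w (insert v \<tau>)) = 0" for v w
    proof (rule ccontr)
      assume "c (insert w (insert v \<tau>)) \<noteq> 0"
      then have "insert w (insert v \<tau>) \<in> K" using c by (simp add: chain_group_def)
      moreover have "\<forall>\<sigma>\<in>K. finite \<sigma>" using K by (simp add: simplicial_complex_def)
      ultimately have "finite (insert w (insert v \<tau>))" by metis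
      then show False using False by simp
    qed
    then show ?thesis by (simp add: h_def case_prod_beta)
  next
    case True
    define A where "A = {(v, w) \<in> P. ?p v < ?p w}"
    define B where "B = {(v, w) \<in> P. ?p w < ?p v}"
    have ne: "?p v \<noteq> ?p w" if "(v, w) \<in> P" for v w
      using that inj_on_vertex_numbering[OF K] by (auto simp: P_def inj_on_def)
    have "P = A \<union> B" using ne by (force simp: A_def B_def)
    moreover have "A \<inter> B = {}" by (auto simp: A_def B_def)
    moreover have "finite A" "finite B" using finP by (auto simp: A_def B_def intro: finite_subset)
    ultimately have "sum h P = sum h A + sum h B" by (simp add: sum.union_disjoint)
    also have "sum h A = (\<Sum>x\<in>B. - h x)"
    proof (rule sum.reindex_bij_witness[where i = prod.swap and j = prod.swap])
      fix x assume "x \<in> A"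
      then obtain v w where x: "x = (v, w)" "v \<notin> \<tau>" "w \<notin> \<tau>" "?p v < ?p w"
        by (auto simp: A_def P_def)
      show "- h (prod.swap x) = h x"
        using x True by (simp add: h_def incidence_sign_insert insert_commute)
    qed (auto simp: A_def B_def P_def)
    finally show ?thesis by (simp add: sum_negf)
  qed
  finally show "boundary_map K (boundary_map K c) \<tau> = 0 \<tau>" by simp
qed

lemma boundary_map_chain_group:
  assumes K: "simplicial_complex K" and c: "c \<in> chain_group K (i + 1)"
  shows "boundary_map K c \<in> chain_group K i"
proof -
  have "\<tau> \<in> K \<and> face_dim \<tau> = i" if nz: "boundary_map K c \<tau> \<noteq> 0" for \<tau>
  proof -
    obtain v where v: "v \<notin> \<tau>" "c (insert v \<tau>) \<noteq> 0"
      using nz unfolding boundary_map_def by (force elim!: sum.not_neutral_contains_not_neutral)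
    then have "insert v \<tau> \<in> K" "face_dim (insert v \<tau>) = i + 1"
      using c by (auto simp: chain_group_def)
    moreover from this K have "finite \<tau>" "\<tau> \<in> K"
      by (auto simp: simplicial_complex_def)
    ultimately show ?thesis using v by (simp add: face_dim_def)
  qed
  then show ?thesis by (auto simp: chain_group_def)
qed

lemma boundary_group_subset:
  assumes "simplicial_complex K"
  shows "boundary_group K i \<subseteq> cycle_group K i"
proof
  fix b assume "b \<in> boundary_group K i"
  then obtain c where c: "c \<in> chain_group K (i + 1)" "b = boundary_map K c"
    by (auto simp: boundary_group_def)
  show "b \<in> cycle_group K i"
    unfolding cycle_group_def c(2)
    using boundary_boundary[OF assms c(1)] boundary_map_chain_group[OF assms c(1)] by simp
qed

end

(*
  By the Euler-Poincare formula the Eulerian condition says that the alternating sum of the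
  numbers of k-element faces containing a given face is 1. It follows that every triangle lies in two
  facets, that a vertex v lies in 2 deg v - 4 facets and that there are e - n facets, where e
  is the number of edges. By flagness a vertex is adjacent to at most two vertices of a given
  facet, except for the four vertices of the facet and the four vertices opposite to its
  triangles, which are adjacent to three. Hence the degrees of the vertices of a facet sum to
  at most 2n + 8. Summing over all facets gives

    sum_v deg v (2 deg v - 4) <= (2n + 8) (e - n),

  and by the Cauchy-Schwarz inequality the left-hand side is at least
  8 e^2 / n - 8 e = (8 e / n) (e - n), so that e <= n^2 / 4 + n after division by e - n > 0.
*)

theory Submission
  imports Defs
begin

subsection \<open>The Euler-Poincare formula\<close>

text \<open>The coefficients of \<open>x\<close> over \<open>C\<close> vanish outside
  \<open>B\<close> and also outside \<open>C - B\<close>, hence everywhere.\<close>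

lemma (in vector_space) span_Int_span_Diff:
  assumes "independent C" "B \<subseteq> C" "x \<in> span B" "x \<in> span (C - B)"
  shows "x = 0"
proof -
  have x: "x \<in> span C" using assms span_mono by blast
  have "representation C x b = 0" for b
  proof -
    have "representation C x = representation B x" "representation C x = representation (C - B) x"
      using assms representation_extend by blast+
    then show ?thesis
      by (metis DiffD2 representation_ne_zero)
  qed
  then show ?thesis
    using sum_nonzero_representation_eq[OF assms(1) x] by simp
qed

text \<open>Rank-nullity for the restriction of \<open>f\<close> to \<open>V\<close>: a basis
  \<open>B\<close> of the kernel extends to a basis \<open>C\<close> of \<open>V\<close>, and
  \<open>f\<close> maps \<open>C - B\<close> bijectively onto a basis of the image. The finite set
  \<open>W\<close> forces \<open>C\<close> to be finite.\<close>

lemma (in Vector_Spaces.linear) dim_kernel_image: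
  assumes V: "vs1.subspace V" and fin: "finite W" "V \<subseteq> vs1.span W"
  shows "vs1.dim V = vs1.dim {x \<in> V. f x = 0} + vs2.dim (f ` V)"
proof -
  let ?N = "{x \<in> V. f x = 0}"
  obtain B where B: "B \<subseteq> ?N" "vs1.independent B" "?N \<subseteq> vs1.span B"
    by (rule vs1.maximal_independent_subset)
  have "B \<subseteq> V" using B by auto
  then obtain C where C: "B \<subseteq> C" "C \<subseteq> V" "vs1.independent C" "V \<subseteq> vs1.span C"
    using B vs1.maximal_independent_subset_extend by metis
  have "finite C"
    using vs1.independent_span_bound[OF fin(1) C(3)] C(2) fin(2) by blast
  \<comment> \<open>A kernel vector in the span of \<open>C - B\<close> also lies in the span of
    \<open>B\<close>, so it is 0.\<close>
  have inj: "inj_on f (vs1.span (C - B))"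
    unfolding inj_on_iff_eq_0[OF vs1.subspace_span]
  proof (intro ballI impI)
    fix x assume x: "x \<in> vs1.span (C - B)" "f x = 0"
    have "vs1.span (C - B) \<subseteq> V"
      using C(2) V by (intro vs1.span_minimal) auto
    then have "x \<in> vs1.span B" using x B(3) by auto
    then show "x = 0" using vs1.span_Int_span_Diff C x by blast
  qed
  have ind: "vs2.independent (f ` (C - B))"
    using inj vs1.independent_mono[OF C(3)] by (intro independent_injective_image) auto
  have "f ` V \<subseteq> f ` vs1.span C" using C(4) by auto
  also have "\<dots> = vs2.span (f ` C)" by (simp add: span_image)
  \<comment> \<open>The vectors of \<open>B\<close> are all sent to 0, which adds nothing to the
    span.\<close>
  also have "\<dots> \<subseteq> vs2.span (insert 0 (f ` (C - B)))"
    using B(1) by (intro vs2.span_mono) auto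
  finally have "f ` V \<subseteq> vs2.span (f ` (C - B))" by simp
  then have "card (f ` (C - B)) = vs2.dim (f ` V)"
    using C(2) ind by (intro vs2.basis_card_eq_dim) auto
  moreover have "card (f ` (C - B)) = card C - card B"
    using inj vs1.span_superset C(1) \<open>finite C\<close>
    by (metis card_image inj_on_subset card_Diff_subset finite_subset)
  moreover have "card B = vs1.dim ?N" "card C = vs1.dim V"
    using B C by (simp_all add: vs1.basis_card_eq_dim)
  moreover have "card B \<le> card C" using C(1) \<open>finite C\<close> by (rule card_mono[rotated])
  ultimately show ?thesis by linarith
qed

section \<open>Dimensions of the chain groups\<close>

lemma sum_apply_fun: "(\<Sum>x\<in>A. f x) y = (\<Sum>x\<in>A. f x y)"
  by (induction A rule: infinite_finite_induct) auto

lemma finite_simplicial_complex: "simplicial_complex K \<Longrightarrow> finite K"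
  and finite_face: "simplicial_complex K \<Longrightarrow> \<sigma> \<in> K \<Longrightarrow> finite \<sigma>"
  and face_subset: "simplicial_complex K \<Longrightarrow> \<sigma> \<in> K \<Longrightarrow> \<tau> \<subseteq> \<sigma> \<Longrightarrow> \<tau> \<in> K"
  and empty_face: "simplicial_complex K \<Longrightarrow> {} \<in> K"
  by (auto simp: simplicial_complex_def)

text \<open>The standard basis vector of a single face; those of the \<open>i\<close>-dimensional
  faces form a basis of \<open>chain_group K i\<close>.\<close>

definition elementary_chain :: "'a set \<Rightarrow> 'a set \<Rightarrow> 'k::field" where
  "elementary_chain \<sigma> = (\<lambda>\<tau>. if \<tau> = \<sigma> then 1 else 0)"

lemma inj_elementary_chain: "inj (elementary_chain :: 'a set \<Rightarrow> 'a set \<Rightarrow> 'k::field)"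
proof (rule injI)
  fix \<sigma> \<tau> assume "(elementary_chain \<sigma> :: 'a set \<Rightarrow> 'k) = elementary_chain \<tau>"
  then have "(elementary_chain \<sigma> \<sigma> :: 'k) = elementary_chain \<tau> \<sigma>" by simp
  then show "\<sigma> = \<tau>" by (simp add: elementary_chain_def split: if_splits)
qed

lemma sum_elementary_chain:
  assumes "finite F"
  shows "(\<Sum>\<sigma>\<in>F. chain_scale (a \<sigma>) (elementary_chain \<sigma>)) \<tau> = (if \<tau> \<in> F then a \<tau> else 0)"
  using assms
  by (simp add: sum_apply_fun chain_scale_def elementary_chain_def if_distrib[of "(*) _"] cong: if_cong)

lemma independent_elementary_chains:
  assumes "finite F"
  shows "chains.independent (elementary_chain ` F :: ('a set \<Rightarrow> 'k::field) set)"
proof (rule chains.independent_if_scalars_zero)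
  fix f :: "('a set \<Rightarrow> 'k) \<Rightarrow> 'k" and x :: "'a set \<Rightarrow> 'k"
  assume 0: "(\<Sum>x\<in>elementary_chain ` F. chain_scale (f x) x) = 0" and "x \<in> elementary_chain ` F"
  then obtain \<tau> where \<tau>: "\<tau> \<in> F" "x = elementary_chain \<tau>" by auto
  have "(\<Sum>\<sigma>\<in>F. chain_scale (f (elementary_chain \<sigma>)) (elementary_chain \<sigma>)) = 0"
    using 0 by (simp add: sum.reindex[OF inj_on_subset[OF inj_elementary_chain subset_UNIV]] o_def)
  from fun_cong[OF this, of \<tau>] show "f x = 0"
    using \<tau> assms by (simp add: sum_elementary_chain)
qed (use assms in simp)

lemma chain_group_span:
  assumes K: "simplicial_complex K"
  shows "chain_group K i \<subseteq>
    chains.span (elementary_chain ` {\<sigma>\<in>K. face_dim \<sigma> = i} :: ('a set \<Rightarrow> 'k::field) set)"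
proof
  fix c :: "'a set \<Rightarrow> 'k" assume c: "c \<in> chain_group K i"
  let ?F = "{\<sigma>\<in>K. face_dim \<sigma> = i}"
  have "c = (\<Sum>\<sigma>\<in>?F. chain_scale (c \<sigma>) (elementary_chain \<sigma>))"
    using c finite_simplicial_complex[OF K]
    by (auto simp: fun_eq_iff sum_elementary_chain chain_group_def)
  then show "c \<in> chains.span (elementary_chain ` ?F)"
    by (metis (no_types, lifting) chains.span_sum chains.span_scale chains.span_base imageI)
qed

lemma dim_chain_group:
  assumes K: "simplicial_complex K"
  shows "chains.dim (chain_group K i :: ('a set \<Rightarrow> 'k::field) set) = face_number i K"
proof -
  let ?F = "{\<sigma>\<in>K. face_dim \<sigma> = i}"
  have "card (elementary_chain ` ?F :: ('a set \<Rightarrow> 'k) set) = chains.dim (chain_group K i :: ('a set \<Rightarrow> 'k) set)"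
    using chain_group_span[OF K] finite_simplicial_complex[OF K]
    by (intro chains.basis_card_eq_dim independent_elementary_chains)
      (auto simp: chain_group_def elementary_chain_def split: if_splits)
  then show ?thesis
    by (simp add: face_number_def card_image[OF inj_on_subset[OF inj_elementary_chain subset_UNIV]])
qed

lemma subspace_chain_group: "chains.subspace (chain_group K i)"
  by (auto simp: chains.subspace_def chain_group_def chain_scale_def) (metis add.left_neutral)+

lemma linear_boundary_map:
  "Vector_Spaces.linear chain_scale chain_scale (boundary_map K)"
  by (intro Vector_Spaces.linear.intro module_hom.intro module_hom_axioms.intro
      chains.vector_space_axioms chains.module_axioms)
    (auto simp: boundary_map_def chain_scale_def fun_eq_iff algebra_simps sum.distrib sum_distrib_left)

text \<open>Rank-nullity for the boundary map on \<open>i\<close>-chains: its kernel is the cycle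
  group in degree \<open>i\<close>, its image the boundary group in degree
  \<open>i - 1\<close>.\<close>

lemma face_number_eq_dim_cycle_boundary:
  assumes K: "simplicial_complex K"
  shows "face_number i K =
    chains.dim (cycle_group K i :: ('a set \<Rightarrow> 'k::field) set) +
    chains.dim (boundary_group K (i - 1) :: ('a set \<Rightarrow> 'k) set)"
proof -
  interpret Vector_Spaces.linear chain_scale chain_scale "boundary_map K :: ('a set \<Rightarrow> 'k) \<Rightarrow> _"
    by (rule linear_boundary_map)
  show ?thesis
    using dim_kernel_image[OF subspace_chain_group _ chain_group_span[OF K], of i]
      finite_simplicial_complex[OF K]
    by (simp add: dim_chain_group[OF K] cycle_group_def boundary_group_def)
qed

text \<open>Rank-nullity in degree \<open>i + 1\<close> writes 0 as a sum of two dimensions, one of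
  which is this one.\<close>

lemma dim_boundary_group_eq_0:
  assumes K: "simplicial_complex K" and "face_number (i + 1) K = 0"
  shows "chains.dim (boundary_group K i :: ('a set \<Rightarrow> 'k::field) set) = 0"
  using face_number_eq_dim_cycle_boundary[OF K, of "i + 1", where 'k = 'k] assms(2) by simp

section \<open>From Betti numbers to face numbers\<close>

text \<open>To be applied to the dimensions \<open>f\<close>, \<open>z\<close>, \<open>b\<close> of
  chains, cycles and boundaries. Each \<open>b i\<close> cancels between consecutive degrees, which
  leaves only the two end terms, in degrees \<open>- 2\<close> and \<open>d\<close>.\<close>

lemma alternating_sum_telescope:
  fixes f z b :: "int \<Rightarrow> int"
  assumes "\<And>i. f i = z i + b (i - 1)" "b (- 2) = 0" "- 1 \<le> d"
  shows "(\<Sum>i = -1..d. parity_sign i * (z i - b i)) =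
    (\<Sum>i = -1..d. parity_sign i * f i) - parity_sign d * b d"
  using assms(3)
proof (induction d rule: int_ge_induct)
  case base
  then show ?case using assms(1)[of "-1"] assms(2) by (simp add: algebra_simps)
next
  case (step d)
  have "{-1..d + 1} = insert (d + 1) {-1..d}" using step.hyps by auto
  then show ?case using step assms(1)[of "d + 1"] by (auto simp: algebra_simps parity_sign_def)
qed

lemma complex_dim_ge:
  assumes "simplicial_complex K" "\<sigma> \<in> K"
  shows "face_dim \<sigma> \<le> complex_dim K"
  using assms unfolding complex_dim_def simplicial_complex_def by (intro Max_ge) auto

text \<open>The Euler-Poincare formula: both end terms of the telescoping sum vanish, since there
  are no faces above the top dimension and no nonzero chains in degree -2.\<close>

lemma reduced_euler_char_face_numbers:
  fixes K :: "'a set set" and F :: "'k::field itself"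
  assumes K: "simplicial_complex K"
  shows "reduced_euler_char F K =
    (\<Sum>i = -1..complex_dim K. parity_sign i * int (face_number i K))"
proof -
  let ?z = "\<lambda>i. int (chains.dim (cycle_group K i :: ('a set \<Rightarrow> 'k) set))"
  let ?b = "\<lambda>i. int (chains.dim (boundary_group K i :: ('a set \<Rightarrow> 'k) set))"
  have d: "- 1 \<le> complex_dim K"
    using complex_dim_ge[OF K empty_face[OF K]] by (simp add: face_dim_def)
  have top: "face_number (complex_dim K + 1) K = 0"
  proof -
    have "{\<sigma>\<in>K. face_dim \<sigma> = complex_dim K + 1} = {}"
      using complex_dim_ge[OF K] by force
    then show ?thesis unfolding face_number_def by (simp only: card.empty)
  qed
  have "?b (complex_dim K) = 0"
    using dim_boundary_group_eq_0[OF K top] by simp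
  moreover have "?b (- 2) = 0"
  proof -
    have "chain_group K (- 2) \<subseteq> {0 :: 'a set \<Rightarrow> 'k}"
      unfolding chain_group_def face_dim_def by force
    then have "boundary_group K (- 2) \<subseteq> chains.span ({} :: ('a set \<Rightarrow> 'k) set)"
      using boundary_group_subset[OF K, of "- 2"] by (auto simp: cycle_group_def)
    from chains.dim_le_card[OF this finite.emptyI] show ?thesis by simp
  qed
  ultimately show ?thesis
    using alternating_sum_telescope[of "\<lambda>i. int (face_number i K)" ?z ?b "complex_dim K"]
      face_number_eq_dim_cycle_boundary[OF K, where 'k = 'k] d
    by (simp add: reduced_euler_char_def reduced_betti_def)
qed

subsection \<open>Links and cofaces in Eulerian complexes\<close>

lemma simplicial_complex_link:
  assumes K: "simplicial_complex K" and "\<sigma> \<in> K"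
  shows "simplicial_complex (link K \<sigma>)"
  unfolding simplicial_complex_def
proof (intro conjI ballI allI impI)
  have "link K \<sigma> \<subseteq> (\<lambda>\<tau>. \<tau> - \<sigma>) ` K" by (auto simp: link_def)
  then show "finite (link K \<sigma>)"
    using finite_simplicial_complex[OF K] finite_surj by blast
  show "{} \<in> link K \<sigma>" using assms by (auto simp: link_def)
next
  fix \<rho> assume "\<rho> \<in> link K \<sigma>"
  then show "finite \<rho>" using finite_face[OF K] by (auto simp: link_def)
next
  fix \<rho> \<rho>' assume "\<rho> \<in> link K \<sigma>" "\<rho>' \<subseteq> \<rho>"
  then obtain \<tau> where \<tau>: "\<sigma> \<subseteq> \<tau>" "\<tau> \<in> K" "\<rho>' \<subseteq> \<tau> - \<sigma>" by (auto simp: link_def)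
  then have "\<rho>' = (\<sigma> \<union> \<rho>') - \<sigma>" "\<sigma> \<union> \<rho>' \<in> K"
    by (auto intro: face_subset[OF K, of \<tau>])
  then show "\<rho>' \<in> link K \<sigma>" unfolding link_def by blast
qed

text \<open>A maximal face above \<open>\<sigma>\<close> is a facet, and so is any face of top
  dimension; purity equates their dimensions.\<close>

lemma pure_obtain_facet:
  assumes K: "simplicial_complex K" and "pure K" "\<sigma> \<in> K"
  obtains \<tau> where "\<tau> \<in> K" "\<sigma> \<subseteq> \<tau>" "face_dim \<tau> = complex_dim K"
proof -
  have fin: "finite K" by (rule finite_simplicial_complex[OF K])
  obtain \<tau> where \<tau>: "\<tau> \<in> K" "\<sigma> \<subseteq> \<tau>" "\<And>\<rho>. \<rho> \<in> K \<Longrightarrow> \<tau> \<subseteq> \<rho> \<Longrightarrow> \<tau> = \<rho>"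
    using finite_has_maximal2[OF fin \<open>\<sigma> \<in> K\<close>] by metis
  have "complex_dim K \<in> face_dim ` K"
    unfolding complex_dim_def using fin assms(3) by (intro Max_in) auto
  then obtain \<phi> where \<phi>: "\<phi> \<in> K" "face_dim \<phi> = complex_dim K" by auto
  have "facet K \<phi>"
    unfolding facet_def
  proof (intro conjI ballI impI)
    fix \<rho> assume \<rho>: "\<rho> \<in> K" "\<phi> \<subseteq> \<rho>"
    then have "card \<rho> \<le> card \<phi>"
      using complex_dim_ge[OF K \<rho>(1)] \<phi> by (simp add: face_dim_def)
    then show "\<rho> = \<phi>" using \<rho> finite_face[OF K \<rho>(1)] by (metis card_seteq)
  qed (rule \<phi>)
  moreover have "facet K \<tau>" using \<tau> by (auto simp: facet_def)
  ultimately have "face_dim \<tau> = complex_dim K" using \<open>pure K\<close> \<phi>(2) unfolding pure_def by metis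
  then show ?thesis by (rule that[OF \<tau>(1,2)])
qed

text \<open>Removing \<open>\<sigma>\<close> lowers the dimension of each coface by
  \<open>card \<sigma>\<close>, and by purity some coface has top dimension.\<close>

lemma complex_dim_link:
  assumes K: "simplicial_complex K" and pure: "pure K" and \<sigma>: "\<sigma> \<in> K"
  shows "complex_dim (link K \<sigma>) = complex_dim K - int (card \<sigma>)"
  unfolding complex_dim_def[of "link K \<sigma>"]
proof (rule Max_eqI)
  have dim: "face_dim (\<tau> - \<sigma>) = face_dim \<tau> - int (card \<sigma>)" if "\<sigma> \<subseteq> \<tau>" "\<tau> \<in> K" for \<tau>
    using that finite_face[OF K that(2)]
    by (simp add: face_dim_def card_Diff_subset finite_subset of_nat_diff card_mono)
  show "finite (face_dim ` link K \<sigma>)"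
    using finite_simplicial_complex[OF simplicial_complex_link[OF K \<sigma>]] by simp
  show "complex_dim K - int (card \<sigma>) \<in> face_dim ` link K \<sigma>"
  proof -
    obtain \<tau> where \<tau>: "\<tau> \<in> K" "\<sigma> \<subseteq> \<tau>" "face_dim \<tau> = complex_dim K"
      by (rule pure_obtain_facet[OF K pure \<sigma>])
    then have "\<tau> - \<sigma> \<in> link K \<sigma>" unfolding link_def by blast
    then show ?thesis using dim[OF \<tau>(2,1)] \<tau>(3) by force
  qed
  show "y \<le> complex_dim K - int (card \<sigma>)" if y: "y \<in> face_dim ` link K \<sigma>" for y
  proof -
    obtain \<tau> where \<tau>: "\<sigma> \<subseteq> \<tau>" "\<tau> \<in> K" "y = face_dim (\<tau> - \<sigma>)"
      using y by (auto simp: link_def)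
    then show ?thesis using complex_dim_ge[OF K \<tau>(2)] dim by simp
  qed
qed

text \<open>Grouping faces by dimension; the minus sign comes from the dimension being one less than
  the cardinality.\<close>

lemma alternating_sum_face_numbers:
  assumes K: "simplicial_complex K"
  shows "(\<Sum>i = -1..complex_dim K. parity_sign i * int (face_number i K)) =
    - (\<Sum>\<sigma>\<in>K. (- 1) ^ card \<sigma>)"
proof -
  have "(\<Sum>\<sigma>\<in>K. - ((- 1) ^ card \<sigma>) :: int) =
    (\<Sum>i = -1..complex_dim K. \<Sum>\<sigma>\<in>{\<sigma>\<in>K. face_dim \<sigma> = i}. - ((- 1) ^ card \<sigma>))"
    using finite_simplicial_complex[OF K] complex_dim_ge[OF K]
    by (intro sum.group[symmetric]) (auto simp: face_dim_def)
  also have "\<dots> = (\<Sum>i = -1..complex_dim K. \<Sum>\<sigma>\<in>{\<sigma>\<in>K. face_dim \<sigma> = i}. parity_sign i)"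
    by (intro sum.cong refl) (auto simp: face_dim_def parity_sign_def)
  finally show ?thesis by (simp add: face_number_def sum_negf mult.commute)
qed

lemma face_number_eq_card: "face_number (int k - 1) K = card {\<sigma>\<in>K. card \<sigma> = k}"
  by (simp add: face_number_def face_dim_def)

section \<open>Cofaces and their counting\<close>

text \<open>The index is a cardinality, one more than the dimension. With
  \<open>\<sigma> = {}\<close> all faces of that size are collected.\<close>

definition cofaces :: "'a set set \<Rightarrow> 'a set \<Rightarrow> nat \<Rightarrow> 'a set set" where
  "cofaces K \<sigma> k = {\<tau>\<in>K. \<sigma> \<subseteq> \<tau> \<and> card \<tau> = k}"

lemma finite_cofaces: "simplicial_complex K \<Longrightarrow> finite (cofaces K \<sigma> k)"
  by (simp add: cofaces_def finite_simplicial_complex)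

lemma cofaces_self: "simplicial_complex K \<Longrightarrow> \<sigma> \<in> K \<Longrightarrow> cofaces K \<sigma> (card \<sigma>) = {\<sigma>}"
  by (auto simp: cofaces_def) (metis card_subset_eq finite_face subsetD)+

lemma cofaces_smaller: "simplicial_complex K \<Longrightarrow> k < card \<sigma> \<Longrightarrow> cofaces K \<sigma> k = {}"
  by (auto simp: cofaces_def) (metis card_mono finite_face leD)

text \<open>Removing \<open>\<sigma>\<close> matches its cofaces with the faces of its link, at the
  cost of a factor \<open>(- 1) ^ card \<sigma>\<close>; the Euler-Poincare formula then evaluates
  the alternating sum over the link.\<close>

lemma eulerian_sum_cofaces:
  assumes K: "simplicial_complex K" and dim: "complex_dim K + 1 = int m"
    and eul: "eulerian F K" and \<sigma>: "\<sigma> \<in> K"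
  shows "(\<Sum>k\<le>m. (- 1) ^ k * int (card (cofaces K \<sigma> k))) = (- 1) ^ m"
proof -
  let ?U = "{\<tau>\<in>K. \<sigma> \<subseteq> \<tau>}"
  have pure: "pure K" using eul by (simp add: eulerian_def)
  have le: "card \<tau> \<le> m" if "\<tau> \<in> K" for \<tau>
    using complex_dim_ge[OF K that] dim by (simp add: face_dim_def)
  have fin: "finite ?U" using finite_simplicial_complex[OF K] by simp
  have "(\<Sum>k\<le>m. (- 1) ^ k * int (card (cofaces K \<sigma> k))) =
    (\<Sum>k\<le>m. \<Sum>\<tau>\<in>{\<tau>\<in>?U. card \<tau> = k}. (- 1) ^ card \<tau>)"
    by (intro sum.cong refl) (simp add: cofaces_def conj_assoc mult.commute)
  also have "\<dots> = (\<Sum>\<tau>\<in>?U. (- 1) ^ card \<tau>)"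
    using fin le by (intro sum.group) auto
  also have "\<dots> = (\<Sum>\<tau>\<in>?U. (- 1) ^ card \<sigma> * (- 1) ^ card (\<tau> - \<sigma>))"
  proof (intro sum.cong refl)
    fix \<tau> assume "\<tau> \<in> ?U"
    then have "finite \<tau>" "\<sigma> \<subseteq> \<tau>" using finite_face[OF K] by auto
    then have "card \<tau> = card \<sigma> + card (\<tau> - \<sigma>)"
      by (metis card_Diff_subset card_mono finite_subset le_add_diff_inverse)
    then show "(- 1 :: int) ^ card \<tau> = (- 1) ^ card \<sigma> * (- 1) ^ card (\<tau> - \<sigma>)"
      by (simp add: power_add)
  qed
  also have "\<dots> = (- 1) ^ card \<sigma> * (\<Sum>\<rho>\<in>link K \<sigma>. (- 1) ^ card \<rho>)"
  proof -
    have "link K \<sigma> = (\<lambda>\<tau>. \<tau> - \<sigma>) ` ?U" "inj_on (\<lambda>\<tau>. \<tau> - \<sigma>) ?U"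
      by (auto simp: link_def inj_on_def)
    then show ?thesis by (simp add: sum.reindex sum_distrib_left)
  qed
  also have "(\<Sum>\<rho>\<in>link K \<sigma>. (- 1) ^ card \<rho>) = - parity_sign (complex_dim (link K \<sigma>))"
  proof -
    have "reduced_euler_char F (link K \<sigma>) = parity_sign (complex_dim (link K \<sigma>))"
      using eul \<sigma> unfolding eulerian_def by blast
    then show ?thesis
      using reduced_euler_char_face_numbers[OF simplicial_complex_link[OF K \<sigma>], of F]
        alternating_sum_face_numbers[OF simplicial_complex_link[OF K \<sigma>]] by linarith
  qed
  also have "complex_dim (link K \<sigma>) = int m - 1 - int (card \<sigma>)"
    using complex_dim_link[OF K pure \<sigma>] dim by simp
  also have "(- 1) ^ card \<sigma> * - parity_sign (int m - 1 - int (card \<sigma>)) = (- 1) ^ m"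
    by (auto simp: parity_sign_def minus_one_power_iff)
  finally show ?thesis .
qed

text \<open>Double counting of pairs \<open>\<sigma> \<subseteq> \<tau>\<close> of cofaces of
  \<open>\<rho>\<close> with \<open>j\<close> and \<open>j + 1\<close> elements: each
  \<open>\<tau>\<close> contains one such \<open>\<sigma>\<close> for every element of
  \<open>\<tau> - \<rho>\<close> that can be deleted.\<close>

lemma sum_card_cofaces:
  assumes K: "simplicial_complex K"
  shows "(\<Sum>\<sigma>\<in>cofaces K \<rho> j. card (cofaces K \<sigma> (Suc j))) =
    (Suc j - card \<rho>) * card (cofaces K \<rho> (Suc j))"
proof -
  have "(\<Sum>\<sigma>\<in>cofaces K \<rho> j. card {\<tau>\<in>cofaces K \<rho> (Suc j). \<sigma> \<subseteq> \<tau>}) =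
    (\<Sum>\<tau>\<in>cofaces K \<rho> (Suc j). Suc j - card \<rho>)"
  proof (rule sum_multicount_gen)
    show "\<forall>\<tau>\<in>cofaces K \<rho> (Suc j). card {\<sigma>\<in>cofaces K \<rho> j. \<sigma> \<subseteq> \<tau>} = Suc j - card \<rho>"
    proof
      fix \<tau> assume \<tau>: "\<tau> \<in> cofaces K \<rho> (Suc j)"
      then have fin: "finite \<tau>" and [simp]: "card \<tau> = Suc j" and "\<rho> \<subseteq> \<tau>" "\<tau> \<in> K"
        using finite_face[OF K] by (auto simp: cofaces_def)
      have "{\<sigma>\<in>cofaces K \<rho> j. \<sigma> \<subseteq> \<tau>} = (\<lambda>x. \<tau> - {x}) ` (\<tau> - \<rho>)"
      proof (intro equalityI subsetI)
        fix \<sigma> assume "\<sigma> \<in> {\<sigma>\<in>cofaces K \<rho> j. \<sigma> \<subseteq> \<tau>}"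
        then have \<sigma>: "\<rho> \<subseteq> \<sigma>" "card \<sigma> = j" "\<sigma> \<subseteq> \<tau>" by (auto simp: cofaces_def)
        then have "card (\<tau> - \<sigma>) = 1" using fin by (simp add: card_Diff_subset finite_subset)
        then obtain x where "\<tau> - \<sigma> = {x}" by (metis card_1_singletonE)
        then show "\<sigma> \<in> (\<lambda>x. \<tau> - {x}) ` (\<tau> - \<rho>)" using \<sigma> by (intro image_eqI[of _ _ x]) auto
      next
        fix \<sigma> assume "\<sigma> \<in> (\<lambda>x. \<tau> - {x}) ` (\<tau> - \<rho>)"
        then show "\<sigma> \<in> {\<sigma>\<in>cofaces K \<rho> j. \<sigma> \<subseteq> \<tau>}"
          using \<open>\<rho> \<subseteq> \<tau>\<close> \<open>\<tau> \<in> K\<close> fin by (auto simp: cofaces_def intro: face_subset[OF K])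
      qed
      moreover have "inj_on (\<lambda>x. \<tau> - {x}) (\<tau> - \<rho>)" by (auto simp: inj_on_def)
      ultimately show "card {\<sigma>\<in>cofaces K \<rho> j. \<sigma> \<subseteq> \<tau>} = Suc j - card \<rho>"
        using fin \<open>\<rho> \<subseteq> \<tau>\<close> by (simp add: card_image card_Diff_subset finite_subset)
    qed
  qed (simp_all add: finite_cofaces[OF K])
  moreover have "{\<tau>\<in>cofaces K \<rho> (Suc j). \<sigma> \<subseteq> \<tau>} = cofaces K \<sigma> (Suc j)"
    if "\<sigma> \<in> cofaces K \<rho> j" for \<sigma>
    using that by (auto simp: cofaces_def)
  ultimately show ?thesis by simp
qed

text \<open>Cliques are faces: otherwise an inclusion-minimal non-face inside \<open>S\<close> would
  be a pair of non-adjacent vertices.\<close>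

lemma flag_face:
  assumes K: "simplicial_complex K" and "flag K" and S: "S \<subseteq> vertices K"
    and adj: "\<And>u v. u \<in> S \<Longrightarrow> v \<in> S \<Longrightarrow> u \<noteq> v \<Longrightarrow> {u, v} \<in> K"
  shows "S \<in> K"
proof (rule ccontr)
  assume "S \<notin> K"
  have "finite S" using S finite_vertices[OF K] finite_subset by blast
  then have "finite {T. T \<subseteq> S \<and> T \<notin> K}" by simp
  then obtain T where T: "T \<subseteq> S" "T \<notin> K"
    and min: "\<And>U. U \<subseteq> S \<Longrightarrow> U \<notin> K \<Longrightarrow> U \<subseteq> T \<Longrightarrow> T = U"
    using finite_has_minimal2[of "{T. T \<subseteq> S \<and> T \<notin> K}" S] \<open>S \<notin> K\<close> by auto
  then have "minimal_nonface K T"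
    using S unfolding minimal_nonface_def by blast
  then have "card T = 2" using \<open>flag K\<close> by (simp add: flag_def)
  then obtain u v where "T = {u, v}" "u \<noteq> v" by (meson card_2_iff)
  then show False using adj T by auto
qed

text \<open>Edges at \<open>v\<close> correspond to their other ends, so this count is the degree of
  \<open>v\<close> in the graph.\<close>

lemma card_cofaces_singleton:
  assumes K: "simplicial_complex K"
  shows "card (cofaces K {v} 2) = card {w\<in>vertices K. w \<noteq> v \<and> {v, w} \<in> K}"
proof -
  have "cofaces K {v} 2 = (\<lambda>w. {v, w}) ` {w\<in>vertices K. w \<noteq> v \<and> {v, w} \<in> K}"
    by (auto simp: cofaces_def card_2_iff vertices_def image_iff) (metis insert_commute insertI1)+
  moreover have "inj_on (\<lambda>w. {v, w}) {w\<in>vertices K. w \<noteq> v \<and> {v, w} \<in> K}"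
    by (auto simp: inj_on_def doubleton_eq_iff)
  ultimately show ?thesis by (simp add: card_image)
qed

lemma cofaces_empty_1: "simplicial_complex K \<Longrightarrow> cofaces K {} 1 = (\<lambda>v. {v}) ` vertices K"
  by (auto simp: cofaces_def card_1_singleton_iff vertices_def image_iff intro: face_subset)

lemma face_number_eq_card_cofaces: "face_number (int k - 1) K = card (cofaces K {} k)"
  by (simp add: face_number_eq_card cofaces_def)

text \<open>Cauchy-Schwarz against the constant 1, from the nonnegativity of the variance.
  Deviations from the mean are scaled by \<open>card A\<close> to stay within the integers.\<close>

lemma sum_squared_le:
  fixes x :: "'a \<Rightarrow> int"
  assumes "finite A"
  shows "(\<Sum>i\<in>A. x i)\<^sup>2 \<le> int (card A) * (\<Sum>i\<in>A. (x i)\<^sup>2)"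
proof (cases "A = {}")
  case False
  let ?S = "\<Sum>i\<in>A. x i" and ?n = "int (card A)"
  have "0 \<le> (\<Sum>i\<in>A. (?n * x i - ?S)\<^sup>2)" by (simp add: sum_nonneg)
  also have "\<dots> = (\<Sum>i\<in>A. ?n\<^sup>2 * (x i)\<^sup>2 - 2 * ?n * ?S * x i + ?S\<^sup>2)"
    by (intro sum.cong) (auto simp: power2_eq_square algebra_simps)
  also have "\<dots> = ?n\<^sup>2 * (\<Sum>i\<in>A. (x i)\<^sup>2) - 2 * ?n * ?S * ?S + ?n * ?S\<^sup>2"
    by (simp add: sum.distrib sum_subtractf sum_distrib_left)
  also have "\<dots> = ?n * (?n * (\<Sum>i\<in>A. (x i)\<^sup>2) - ?S\<^sup>2)"
    by (simp add: power2_eq_square algebra_simps)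
  finally show ?thesis
    using False assms by (simp add: zero_le_mult_iff card_gt_0_iff)
qed simp

subsection \<open>Flag Eulerian complexes of dimension three\<close>

locale flag_eulerian_3 =
  fixes K :: "'a set set" and F :: "'k::field itself"
  assumes K: "simplicial_complex K" and flag: "flag K"
    and dim: "complex_dim K = 3" and eul: "eulerian F K"
begin

section \<open>Consequences of the Euler relations\<close>

abbreviation "V \<equiv> vertices K"
abbreviation "deg v \<equiv> card (cofaces K {v} 2)"

lemma card_face_le: "\<sigma> \<in> K \<Longrightarrow> card \<sigma> \<le> 4"
  using complex_dim_ge[OF K] dim by (force simp: face_dim_def)

lemma euler_relation:
  assumes "\<sigma> \<in> K"
  shows "(\<Sum>k\<le>4. (- 1) ^ k * int (card (cofaces K \<sigma> k))) = 1"
  using eulerian_sum_cofaces[OF K _ eul assms, of 4] dim by simp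

text \<open>Only sizes 3 and 4 contribute to the Euler relation of a triangle, which reads
  \<open>- 1 + x = 1\<close>.\<close>

lemma card_cofaces_triangle:
  assumes "\<tau> \<in> K" "card \<tau> = 3"
  shows "card (cofaces K \<tau> 4) = 2"
  using euler_relation[OF assms(1)] cofaces_self[OF K assms(1)] cofaces_smaller[OF K, of _ \<tau>] assms(2)
  by (simp add: numeral_eq_Suc)

text \<open>Incidences of triangles and facets above \<open>\<rho>\<close>, counted twice: a
  triangle lies in two facets, and a facet has \<open>4 - card \<rho>\<close> triangles containing
  \<open>\<rho>\<close>.\<close>

lemma card_facets_eq_triangles:
  assumes "\<rho> \<in> K"
  shows "2 * card (cofaces K \<rho> 3) = (4 - card \<rho>) * card (cofaces K \<rho> 4)"
proof -
  have "(\<Sum>\<tau>\<in>cofaces K \<rho> 3. card (cofaces K \<tau> 4)) = 2 * card (cofaces K \<rho> 3)"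
    using card_cofaces_triangle by (simp add: cofaces_def)
  then show ?thesis using sum_card_cofaces[OF K, where \<rho> = \<rho> and j = 3] by simp
qed

text \<open>With \<open>t\<close> triangles and \<open>f\<close> facets at \<open>v\<close>, the
  Euler relation is \<open>- 1 + deg v - t + f = 1\<close>; substitute
  \<open>2 * t = 3 * f\<close>.\<close>

lemma card_facets_vertex:
  assumes "v \<in> V"
  shows "card (cofaces K {v} 4) + 4 = 2 * deg v"
proof -
  have v: "{v} \<in> K" using assms face_subset[OF K] by (auto simp: vertices_def)
  show ?thesis
    using euler_relation[OF v] cofaces_self[OF K v] cofaces_smaller[OF K, of 0 "{v}"]
      card_facets_eq_triangles[OF v]
    by (simp add: numeral_eq_Suc)
qed

text \<open>The Euler relation of the empty face, with triangles eliminated by the fact that they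
  are twice as many as the facets.\<close>

lemma card_facets: "card (cofaces K {} 4) + card V = card (cofaces K {} 2)"
  using euler_relation[OF empty_face[OF K]] cofaces_self[OF K empty_face[OF K]]
    card_facets_eq_triangles[OF empty_face[OF K]] cofaces_empty_1[OF K]
  by (simp add: numeral_eq_Suc card_image)

lemma sum_deg: "(\<Sum>v\<in>V. deg v) = 2 * card (cofaces K {} 2)"
  using sum_card_cofaces[OF K, where \<rho> = "{}" and j = 1] cofaces_empty_1[OF K]
  by (simp add: sum.reindex numeral_2_eq_2)

section \<open>Adjacency to a fixed facet\<close>

context
  fixes \<sigma> assumes \<sigma>: "\<sigma> \<in> cofaces K {} 4"
begin

definition "nbrs w = {v\<in>\<sigma>. v \<noteq> w \<and> {v, w} \<in> K}"
definition "opposite = {w\<in>V - \<sigma>. card (nbrs w) = 3}"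

lemma facet_facts: "\<sigma> \<in> K" "card \<sigma> = 4" "finite \<sigma>" "\<sigma> \<subseteq> V"
  using \<sigma> finite_face[OF K] by (auto simp: cofaces_def vertices_def)

text \<open>The set is a clique: its elements in \<open>\<sigma>\<close> are pairwise adjacent, and
  \<open>w\<close> is adjacent to each of \<open>nbrs w\<close>.\<close>

lemma insert_nbrs_face:
  assumes "w \<in> V"
  shows "insert w (nbrs w) \<in> K"
proof (rule flag_face[OF K flag])
  fix u v assume "u \<in> insert w (nbrs w)" "v \<in> insert w (nbrs w)" "u \<noteq> v"
  then consider "u \<in> nbrs w" "v \<in> nbrs w" | "u = w" "v \<in> nbrs w" | "u \<in> nbrs w" "v = w" by blast
  then show "{u, v} \<in> K"
  proof cases
    case 1
    then have "{u, v} \<subseteq> \<sigma>" by (simp add: nbrs_def)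
    then show ?thesis by (rule face_subset[OF K facet_facts(1)])
  next
    case 2
    then show ?thesis by (simp add: nbrs_def insert_commute)
  next
    case 3
    then show ?thesis by (simp add: nbrs_def)
  qed
next
  have "nbrs w \<subseteq> V" using facet_facts(4) unfolding nbrs_def by blast
  then show "insert w (nbrs w) \<subseteq> V" using assms by simp
qed

text \<open>Together with \<open>w\<close> these neighbours form a face, which has at most four
  elements.\<close>

lemma card_nbrs_le:
  assumes "w \<in> V"
  shows "card (nbrs w) \<le> 3"
proof -
  have "finite (nbrs w)" "w \<notin> nbrs w" using facet_facts by (auto simp: nbrs_def)
  then show ?thesis using card_face_le[OF insert_nbrs_face[OF assms]] by simp
qed

text \<open>
  A triangle of \<open>\<sigma>\<close> lies in exactly one facet besides \<open>\<sigma>\<close>, and the vertex completing it to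
  that facet is adjacent to no fourth vertex of \<open>\<sigma>\<close>, as flagness would give a 5-element face.
\<close>

lemma bij_betw_opposite: "bij_betw nbrs opposite {\<tau>. \<tau> \<subseteq> \<sigma> \<and> card \<tau> = 3}"
  unfolding bij_betw_def
proof (intro conjI equalityI subsetI)
  have coface: "insert w (nbrs w) \<in> cofaces K (nbrs w) 4" "w \<notin> \<sigma>" "\<sigma> \<in> cofaces K (nbrs w) 4"
    "card (cofaces K (nbrs w) 4) = 2" if "w \<in> opposite" for w
  proof -
    have w: "w \<in> V" "w \<notin> \<sigma>" "card (nbrs w) = 3" "nbrs w \<subseteq> \<sigma>" "finite (nbrs w)" "w \<notin> nbrs w"
      using that facet_facts by (auto simp: opposite_def nbrs_def)
    then show "insert w (nbrs w) \<in> cofaces K (nbrs w) 4" "w \<notin> \<sigma>" "\<sigma> \<in> cofaces K (nbrs w) 4"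
      using insert_nbrs_face facet_facts by (auto simp: cofaces_def)
    show "card (cofaces K (nbrs w) 4) = 2"
      using w facet_facts by (intro card_cofaces_triangle) (auto intro: face_subset[OF K])
  qed
  show "inj_on nbrs opposite"
  proof (rule inj_onI, rule ccontr)
    fix w w' assume w: "w \<in> opposite" "w' \<in> opposite" "nbrs w = nbrs w'" "w \<noteq> w'"
    \<comment> \<open>Two opposite vertices over the same triangle would put it in three distinct
      facets instead of two.\<close>
    let ?A = "{insert w (nbrs w), insert w' (nbrs w), \<sigma>}"
    have "insert w (nbrs w) \<noteq> insert w' (nbrs w)"
      using w coface(2)[OF w(1)] coface(2)[OF w(2)] by (auto simp: nbrs_def)
    moreover have "insert w (nbrs w) \<noteq> \<sigma>" "insert w' (nbrs w) \<noteq> \<sigma>"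
      using coface(2)[OF w(1)] coface(2)[OF w(2)] by auto
    ultimately have "card ?A = 3" by simp
    moreover have "?A \<subseteq> cofaces K (nbrs w) 4"
      using coface[OF w(1)] coface[OF w(2)] w(3) by auto
    ultimately have "3 \<le> card (cofaces K (nbrs w) 4)"
      by (metis card_mono finite_cofaces[OF K])
    then show False using coface(4)[OF w(1)] by simp
  qed
next
  fix \<tau> assume "\<tau> \<in> nbrs ` opposite"
  then show "\<tau> \<in> {\<tau>. \<tau> \<subseteq> \<sigma> \<and> card \<tau> = 3}" by (auto simp: opposite_def nbrs_def)
next
  fix \<tau> assume "\<tau> \<in> {\<tau>. \<tau> \<subseteq> \<sigma> \<and> card \<tau> = 3}"
  then have \<tau>: "\<tau> \<subseteq> \<sigma>" "card \<tau> = 3" "\<tau> \<in> K" "finite \<tau>"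
    using facet_facts face_subset[OF K] finite_subset by auto
  have "card (cofaces K \<tau> 4) = 2" "\<sigma> \<in> cofaces K \<tau> 4"
    using card_cofaces_triangle \<tau> facet_facts by (auto simp: cofaces_def)
  \<comment> \<open>The second facet through \<open>\<tau>\<close>; its vertex outside
    \<open>\<tau>\<close> is the preimage sought.\<close>
  then obtain \<rho> where "\<rho> \<in> cofaces K \<tau> 4" "\<rho> \<noteq> \<sigma>"
    by (metis card_2_iff')
  then have \<rho>: "\<rho> \<in> K" "\<tau> \<subseteq> \<rho>" "card \<rho> = 4" "\<rho> \<noteq> \<sigma>" by (auto simp: cofaces_def)
  have "card (\<rho> - \<tau>) = 1" using \<rho> \<tau> by (simp add: card_Diff_subset)
  then obtain w where w: "\<rho> - \<tau> = {w}" by (metis card_1_singletonE)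
  have "w \<in> V" using w \<rho> by (auto simp: vertices_def)
  have "w \<notin> \<sigma>"
  proof
    assume "w \<in> \<sigma>"
    then have "\<rho> \<subseteq> \<sigma>" using w \<tau> by auto
    then show False using \<rho> facet_facts card_subset_eq by metis
  qed
  have "\<tau> \<subseteq> nbrs w"
    using w \<tau> \<rho> by (auto simp: nbrs_def intro!: face_subset[OF K \<rho>(1)])
  moreover have "finite (nbrs w)" using facet_facts by (simp add: nbrs_def)
  ultimately have "nbrs w = \<tau>"
    using card_nbrs_le[OF \<open>w \<in> V\<close>] \<tau> by (metis card_seteq)
  then show "\<tau> \<in> nbrs ` opposite"
    using \<tau> \<open>w \<in> V\<close> \<open>w \<notin> \<sigma>\<close> by (intro image_eqI[of _ _ w]) (auto simp: opposite_def)
qed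

lemma card_opposite: "card opposite = 4"
  using bij_betw_same_card[OF bij_betw_opposite] n_subsets[OF facet_facts(3), of 3] facet_facts(2)
  by (simp add: numeral_eq_Suc)

text \<open>The facet and its four opposite vertices are disjoint. The bound ensures that both
  cycles of \<open>J2 n\<close> have at least three vertices.\<close>

lemma card_vertices_ge: "8 \<le> card V"
proof -
  have "card (\<sigma> \<union> opposite) \<le> card V"
    using facet_facts finite_vertices[OF K] by (intro card_mono) (auto simp: opposite_def)
  moreover have "card (\<sigma> \<union> opposite) = card \<sigma> + card opposite"
    using facet_facts finite_vertices[OF K] by (intro card_Un_disjoint) (auto simp: opposite_def)
  ultimately show ?thesis using card_opposite facet_facts by simp
qed

lemma sum_deg_facet_le: "(\<Sum>v\<in>\<sigma>. deg v) \<le> 2 * card V + 8"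
proof -
  have "(\<Sum>v\<in>\<sigma>. deg v) = (\<Sum>v\<in>\<sigma>. card {w\<in>V. w \<noteq> v \<and> {v, w} \<in> K})"
    by (simp add: card_cofaces_singleton[OF K])
  \<comment> \<open>Adjacent pairs with one vertex in \<open>\<sigma>\<close> are counted from the
    other end.\<close>
  also have "\<dots> = (\<Sum>w\<in>V. card (nbrs w))"
    using facet_facts finite_vertices[OF K]
    by (intro sum_multicount_gen) (auto simp: nbrs_def intro!: arg_cong[of _ _ card])
  \<comment> \<open>A vertex outside \<open>\<sigma>\<close> with three neighbours there is opposite
    by definition; the two corrections add 4 each.\<close>
  also have "\<dots> \<le> (\<Sum>w\<in>V. 2 + (if w \<in> \<sigma> then 1 else 0) + (if w \<in> opposite then 1 else 0))"
    using card_nbrs_le by (intro sum_mono) (fastforce simp: opposite_def)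
  also have "\<dots> = 2 * card V + card (V \<inter> \<sigma>) + card (V \<inter> opposite)"
    using finite_vertices[OF K] by (simp only: sum.distrib) (simp add: sum.If_cases)
  also have "V \<inter> \<sigma> = \<sigma>" using facet_facts by auto
  also have "V \<inter> opposite = opposite" by (auto simp: opposite_def)
  finally show ?thesis using facet_facts card_opposite by simp
qed

end

section \<open>Summation over all facets\<close>

lemma obtain_facet: obtains \<sigma> where "\<sigma> \<in> cofaces K {} 4"
proof -
  have "pure K" using eul by (simp add: eulerian_def)
  then show ?thesis
    using pure_obtain_facet[OF K _ empty_face[OF K]] dim that
    by (auto simp: cofaces_def face_dim_def)
qed

lemma edges_le: "4 * card (cofaces K {} 2) \<le> card V ^ 2 + 4 * card V"
proof -
  let ?T = "cofaces K {} 4"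
  \<comment> \<open>The passage to integers avoids truncated subtraction; \<open>t\<close> is the
    positive factor \<open>e - n\<close> cancelled at the end.\<close>
  define n e t where "n = int (card V)" and "e = int (card (cofaces K {} 2))" and "t = int (card ?T)"
  have t: "e = t + n" "t > 0"
    using card_facets obtain_facet finite_cofaces[OF K]
    by (auto simp: n_def e_def t_def card_gt_0_iff simp flip: of_nat_add)
  \<comment> \<open>Each vertex contributes its degree once for every facet containing it, so the
    order of summation can be exchanged.\<close>
  have "(\<Sum>v\<in>V. deg v * card (cofaces K {v} 4)) = (\<Sum>v\<in>V. \<Sum>\<sigma>\<in>{\<sigma>\<in>?T. v \<in> \<sigma>}. deg v)"
    by (simp add: cofaces_def mult.commute conj_ac)
  also have "\<dots> = (\<Sum>\<sigma>\<in>?T. \<Sum>v\<in>{v\<in>V. v \<in> \<sigma>}. deg v)"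
    by (rule sum.swap_restrict[OF finite_vertices[OF K] finite_cofaces[OF K]])
  also have "\<dots> = (\<Sum>\<sigma>\<in>?T. \<Sum>v\<in>\<sigma>. deg v)"
    by (intro sum.cong) (auto simp: cofaces_def vertices_def)
  also have "\<dots> \<le> card ?T * (2 * card V + 8)"
    using sum_bounded_above[of ?T "\<lambda>\<sigma>. \<Sum>v\<in>\<sigma>. deg v"] sum_deg_facet_le by simp
  finally have "int (\<Sum>v\<in>V. deg v * card (cofaces K {v} 4)) \<le> int (card ?T * (2 * card V + 8))"
    by (rule of_nat_mono)
  then have "(\<Sum>v\<in>V. int (deg v * card (cofaces K {v} 4))) \<le> t * (2 * n + 8)"
    by (simp add: t_def n_def)
  moreover have "int (deg v * card (cofaces K {v} 4)) = 2 * (int (deg v))\<^sup>2 - 4 * int (deg v)"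
    if "v \<in> V" for v
  proof -
    have "int (card (cofaces K {v} 4)) = 2 * int (deg v) - 4"
      using card_facets_vertex[OF that] by simp
    then show ?thesis by (simp only: of_nat_mult) (simp add: power2_eq_square right_diff_distrib)
  qed
  ultimately have "2 * (\<Sum>v\<in>V. (int (deg v))\<^sup>2) - 4 * (\<Sum>v\<in>V. int (deg v)) \<le> t * (2 * n + 8)"
    by (simp add: sum_subtractf sum_distrib_left del: of_nat_mult)
  moreover have S: "(\<Sum>v\<in>V. int (deg v)) = 2 * e"
    using arg_cong[OF sum_deg, of int] by (simp add: e_def)
  ultimately have "2 * (\<Sum>v\<in>V. (int (deg v))\<^sup>2) \<le> t * (2 * n + 8) + 8 * e" by simp
  \<comment> \<open>Multiplying by \<open>n\<close> prepares for Cauchy-Schwarz without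
    division.\<close>
  then have "n * (2 * (\<Sum>v\<in>V. (int (deg v))\<^sup>2)) \<le> n * (t * (2 * n + 8) + 8 * e)"
    by (intro mult_left_mono) (simp_all add: n_def)
  moreover have "(2 * e)\<^sup>2 \<le> n * (\<Sum>v\<in>V. (int (deg v))\<^sup>2)"
    using sum_squared_le[OF finite_vertices[OF K], of "\<lambda>v. int (deg v)"] S by (simp add: n_def)
  \<comment> \<open>The term \<open>8 * e * n\<close> moves to the left, where
    \<open>8 * e * (e - n)\<close> is \<open>t * (8 * e)\<close>.\<close>
  ultimately have "t * (8 * e) \<le> t * (n * (2 * n + 8))"
    using t(1) by (simp add: power2_eq_square algebra_simps)
  then have "8 * e \<le> n * (2 * n + 8)"
    using t(2) by (simp only: mult_le_cancel_left_pos)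
  then have "4 * e \<le> n\<^sup>2 + 4 * n"
    by (simp add: power2_eq_square algebra_simps)
  then have "int (4 * card (cofaces K {} 2)) \<le> int (card V ^ 2 + 4 * card V)"
    by (simp add: e_def n_def)
  then show ?thesis by (simp only: of_nat_le_iff)
qed

end

subsection \<open>The join of two cycles\<close>

text \<open>The preimages under \<open>Inl\<close> and \<open>Inr\<close> recover the two parts, so
  a face of a join determines its components.\<close>

lemma Plus_eq_iff:
  fixes A C :: "'a set" and B D :: "'b set"
  shows "A <+> B = C <+> D \<longleftrightarrow> A = C \<and> B = D"
proof -
  have "Inl -` (X <+> Y) = X" "Inr -` (X <+> Y) = Y" for X :: "'a set" and Y :: "'b set"
    by auto
  then show ?thesis by metis
qed

text \<open>An edge of the join is an edge of one complex joined with the empty face of the other,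
  or a pair of vertices, one from each.\<close>

lemma face_number_1_complex_join:
  fixes K :: "'a set set" and L :: "'b set set"
  assumes K: "simplicial_complex K" and L: "simplicial_complex L"
  shows "face_number 1 (complex_join K L) =
    face_number 1 K + face_number 1 L + face_number 0 K * face_number 0 L"
proof -
  let ?c = "\<lambda>M k. {\<sigma>\<in>M. card \<sigma> = k}"
  let ?j = "\<lambda>(\<sigma>, \<tau>). \<sigma> <+> \<tau>"
  have fin: "finite K" "finite L"
    using K L by (simp_all add: finite_simplicial_complex)
  let ?A = "?c K 2 \<times> {{} :: 'b set}" and ?B = "{{} :: 'a set} \<times> ?c L 2" and ?C = "?c K 1 \<times> ?c L 1"
  have "{\<rho>\<in>complex_join K L. face_dim \<rho> = 1} = ?j ` (?A \<union> ?B \<union> ?C)"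
  proof (intro equalityI subsetI)
    fix \<rho> assume "\<rho> \<in> {\<rho>\<in>complex_join K L. face_dim \<rho> = 1}"
    then obtain \<sigma> \<tau> where \<rho>: "\<rho> = \<sigma> <+> \<tau>" "\<sigma> \<in> K" "\<tau> \<in> L" "card (\<sigma> <+> \<tau>) = 2"
      by (auto simp: complex_join_def face_dim_def)
    then have "card \<sigma> + card \<tau> = 2" and "finite \<sigma>" "finite \<tau>"
      using finite_face[OF K] finite_face[OF L] by (auto simp: card_Plus)
    then consider "card \<sigma> = 2" "card \<tau> = 0" | "card \<sigma> = 0" "card \<tau> = 2" | "card \<sigma> = 1" "card \<tau> = 1"
      by linarith
    then have "(\<sigma>, \<tau>) \<in> ?A \<union> ?B \<union> ?C" using \<rho> \<open>finite \<sigma>\<close> \<open>finite \<tau>\<close> by cases auto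
    then show "\<rho> \<in> ?j ` (?A \<union> ?B \<union> ?C)" using \<rho>(1) by (intro image_eqI[of _ _ "(\<sigma>, \<tau>)"]) auto
  next
    fix \<rho> assume "\<rho> \<in> ?j ` (?A \<union> ?B \<union> ?C)"
    then obtain \<sigma> \<tau> where \<rho>: "\<rho> = \<sigma> <+> \<tau>" "(\<sigma>, \<tau>) \<in> ?A \<union> ?B \<union> ?C" by auto
    then have "\<sigma> \<in> K" "\<tau> \<in> L" "card \<sigma> + card \<tau> = 2"
      using empty_face[OF K] empty_face[OF L] by auto
    then show "\<rho> \<in> {\<rho>\<in>complex_join K L. face_dim \<rho> = 1}"
      using \<rho>(1) finite_face[OF K] finite_face[OF L]
      by (auto simp: complex_join_def face_dim_def card_Plus)
  qed
  moreover have "inj_on ?j (?A \<union> ?B \<union> ?C)"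
    by (rule inj_on_subset[OF _ subset_UNIV]) (simp add: inj_def Plus_eq_iff)
  ultimately have "face_number 1 (complex_join K L) = card (?A \<union> ?B \<union> ?C)"
    by (simp only: face_number_def card_image)
  also have "\<dots> = card (?A \<union> ?B) + card ?C"
    using fin by (intro card_Un_disjoint) auto
  also have "card (?A \<union> ?B) = card ?A + card ?B"
    using fin by (intro card_Un_disjoint) auto
  finally show ?thesis
    using face_number_eq_card[of 2 K] face_number_eq_card[of 1 K]
      face_number_eq_card[of 2 L] face_number_eq_card[of 1 L]
    by (simp add: card_cartesian_product)
qed

lemma simplicial_complex_cycle_complex: "simplicial_complex (cycle_complex m)"
  unfolding simplicial_complex_def
proof (intro conjI ballI allI impI)
  show "finite (cycle_complex m)" by (simp add: cycle_complex_def setcompr_eq_image)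
  show "{} \<in> cycle_complex m" by (simp add: cycle_complex_def)
  show "finite \<sigma>" if "\<sigma> \<in> cycle_complex m" for \<sigma>
    using that by (auto simp: cycle_complex_def)
next
  fix \<sigma> \<tau> assume "\<sigma> \<in> cycle_complex m" and sub: "\<tau> \<subseteq> \<sigma>"
  then consider "\<sigma> = {}" | i where "\<sigma> = {i}" "i < m" | i where "\<sigma> = {i, (i + 1) mod m}" "i < m"
    unfolding cycle_complex_def by blast
  then show "\<tau> \<in> cycle_complex m"
  proof cases
    case 1
    then show ?thesis using sub by (simp add: cycle_complex_def)
  next
    case (2 i)
    then have "\<tau> = {} \<or> \<tau> = {i}" using sub by blast
    then show ?thesis using 2 by (auto simp: cycle_complex_def)
  next
    case (3 i)
    then have "(i + 1) mod m < m" by simp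
    moreover have "\<tau> = {} \<or> \<tau> = {i} \<or> \<tau> = {(i + 1) mod m} \<or> \<tau> = {i, (i + 1) mod m}"
      using 3 sub by blast
    ultimately show ?thesis using 3 unfolding cycle_complex_def by blast
  qed
qed

text \<open>From three vertices on, \<open>{i, (i + 1) mod m}\<close> has two distinct ends and
  determines \<open>i\<close>; for \<open>m = 2\<close> both values of \<open>i\<close> would give
  the same edge.\<close>

lemma face_number_cycle_complex:
  assumes "3 \<le> m"
  shows "face_number 0 (cycle_complex m) = m" "face_number 1 (cycle_complex m) = m"
proof -
  let ?e = "\<lambda>i. {i, (i + 1) mod m}"
  have ne: "(i + 1) mod m \<noteq> i" if "i < m" for i
    using assms that by (auto simp: mod_if)
  have card: "card (?e i) = 2" if "i < m" for i
    using ne[OF that] by simp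
  have "{\<sigma>\<in>cycle_complex m. face_dim \<sigma> = 0} = (\<lambda>i. {i}) ` {..<m}"
    using card unfolding cycle_complex_def by (force simp: face_dim_def)
  then show "face_number 0 (cycle_complex m) = m"
    by (simp add: face_number_def card_image)
  have "{\<sigma>\<in>cycle_complex m. face_dim \<sigma> = 1} = ?e ` {..<m}"
  proof (intro equalityI subsetI)
    fix \<sigma> assume \<sigma>: "\<sigma> \<in> {\<sigma>\<in>cycle_complex m. face_dim \<sigma> = 1}"
    then consider "\<sigma> = {}" | i where "\<sigma> = {i}" | i where "\<sigma> = ?e i" "i < m"
      unfolding cycle_complex_def by blast
    then show "\<sigma> \<in> ?e ` {..<m}" using \<sigma> by cases (simp_all add: face_dim_def)
  next
    fix \<sigma> assume "\<sigma> \<in> ?e ` {..<m}"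
    then obtain i where i: "\<sigma> = ?e i" "i < m" by blast
    then have "\<sigma> \<in> cycle_complex m" unfolding cycle_complex_def by blast
    then show "\<sigma> \<in> {\<sigma>\<in>cycle_complex m. face_dim \<sigma> = 1}"
      using card[OF i(2)] i(1) by (simp add: face_dim_def)
  qed
  moreover have "inj_on ?e {..<m}"
    using assms by (auto simp: inj_on_def doubleton_eq_iff mod_if split: if_splits)
  ultimately show "face_number 1 (cycle_complex m) = m"
    by (simp add: face_number_def card_image)
qed

lemma face_number_1_J2:
  assumes "6 \<le> n"
  shows "face_number 1 (J2 n) = n ^ 2 div 4 + n"
proof -
  have "face_number 1 (J2 n) = n div 2 + (n + 1) div 2 + n div 2 * ((n + 1) div 2)"
    using assms
    by (simp add: J2_def face_number_1_complex_join simplicial_complex_cycle_complex face_number_cycle_complex)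
  \<comment> \<open>For odd \<open>n = 2 * k + 1\<close> the square is
    \<open>4 * (k * (k + 1)) + 1\<close>, and division by 4 drops the remainder 1.\<close>
  moreover have "n div 2 * ((n + 1) div 2) = n ^ 2 div 4"
  proof (cases "even n")
    case True
    then show ?thesis by (auto elim!: evenE simp: power2_eq_square)
  next
    case False
    then obtain k where k: "n = 2 * k + 1" by (auto elim: oddE)
    then have "n ^ 2 = 4 * (k * (k + 1)) + 1" by (simp add: power2_eq_square algebra_simps)
    then show ?thesis using k by simp
  qed
  moreover have "n div 2 + (n + 1) div 2 = n" by presburger
  ultimately show ?thesis by simp
qed

theorem theorem5p4:
  fixes \<Delta> :: "'a set set" and n :: nat
  assumes "simplicial_complex \<Delta>"
    and "flag \<Delta>"
    and "complex_dim \<Delta> = 3"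
    and "eulerian TYPE('k::field) \<Delta>"
    and "card (vertices \<Delta>) = n"
  shows "face_number 1 \<Delta> \<le> face_number 1 (J2 n) \<and>
         face_number 1 (J2 n) = n ^ 2 div 4 + n"
proof -
  interpret flag_eulerian_3 \<Delta> "TYPE('k)"
    by unfold_locales (use assms in auto)
  obtain \<sigma> where "\<sigma> \<in> cofaces \<Delta> {} 4" by (rule obtain_facet)
  then have "8 \<le> n" using card_vertices_ge assms(5) by blast
  then have "face_number 1 (J2 n) = n ^ 2 div 4 + n" by (intro face_number_1_J2) simp
  \<comment> \<open>The edge count is an integer, so the bound divided by 4 may be rounded
    down.\<close>
  moreover have "face_number 1 \<Delta> \<le> n ^ 2 div 4 + n"
    using edges_le assms(5) face_number_eq_card_cofaces[of 2 \<Delta>] by simp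
  ultimately show ?thesis by simp
qed

end
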